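(* (Cube Layered Lemma) For any positive integers $d',m,r$ and any $t\in[m]$, there exists a positive integer $n'=n'(d',m,r)$ (depending only on $d',m,r$) such that the following holds. For every $r$-coloring of $[m]^{n'}$ there is a $d'$-element subset $S'\subseteq[n']$ such that every two $t$-equivalent elements $\mathbf{x},\mathbf{y}$ of the $d'$-subcube $\{\mathbf{z}\in[m]^{n'}: I_t(\mathbf{z})\subseteq S'\}$ receive the same color.
   Context: $[n]=\{1,\dots,n\}$. For $\mathbf{x}=(x_1,\dots,x_n)\in[m]^n$ and $t\in[m]$, $I_t(\mathbf{x})=\{i\in[n]: x_i\ne t\}$. For $I=\{i_1<\cdots<i_p\}\subseteq[n]$, $\mathbf{x}|_I=(x_{i_1},\dots,x_{i_p})$. Two elements $\mathbf{x},\mathbf{y}\in[m]^n$ are $t$-equivalent if the tuples obtained from $\mathbf{x}$ and $\mathbf{y}$ by deleting all coordinates equal to $t$ coincide, i.e. $\mathbf{x}|_{I_t(\mathbf{x})}=\mathbf{y}|_{I_t(\mathbf{y})}$. An $r$-coloring of a set is a map from it to a set of $r$ colors. A $d$-subcube of $[m]^n$ is a set obtained by fixing the coordinates outside some $d$-element set of positions and letting the remaining $d$ coordinates vary freely over $[m]$. *)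

theory Defs
  imports Main "HOL-Library.FuncSet"
begin

text \<open>Tuples are extensional functions on \<open>{1..n}\<close>, so equality in \<open>cube m n\<close> is equality of tuples.\<close>

definition cube :: "nat \<Rightarrow> nat \<Rightarrow> (nat \<Rightarrow> nat) set" where
  "cube m n = ({1..n} \<rightarrow>\<^sub>E {1..m})"

definition positions_ne :: "nat \<Rightarrow> nat \<Rightarrow> (nat \<Rightarrow> nat) \<Rightarrow> nat set" where
  "positions_ne n t x = {i \<in> {1..n}. x i \<noteq> t}"

text \<open>The restriction to a finite index set forgets the positions: it is a list, read in
  increasing order of the indices, so restrictions to different index sets can coincide.\<close>

definition subtuple :: "(nat \<Rightarrow> 'a) \<Rightarrow> nat set \<Rightarrow> 'a list" where
  "subtuple x I = map x (sorted_list_of_set I)"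

definition t_equivalent :: "nat \<Rightarrow> nat \<Rightarrow> (nat \<Rightarrow> nat) \<Rightarrow> (nat \<Rightarrow> nat) \<Rightarrow> bool" where
  "t_equivalent n t x y \<longleftrightarrow>
     subtuple x (positions_ne n t x) = subtuple y (positions_ne n t y)"

definition coloring :: "nat \<Rightarrow> 'a set \<Rightarrow> ('a \<Rightarrow> 'c) \<Rightarrow> bool" where
  "coloring r A c \<longleftrightarrow> (\<exists>C. finite C \<and> card C = r \<and> c \<in> A \<rightarrow> C)"

end

theory Submission
  imports Defs "HOL-Library.Ramsey"
begin

text \<open>
  A point \<open>x\<close> of the cube is determined by the set \<open>I\<close> of positions at which it differs from
  \<open>t\<close> and by the word \<open>w\<close> read along \<open>I\<close>; two points are \<open>t\<close>-equivalent exactly when their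
  words agree. Fix a word \<open>w\<close> of length \<open>p\<close>. Writing \<open>w\<close> along \<open>I\<close> and \<open>t\<close> elsewhere
  (\<open>spread n t w I\<close>) turns the colouring of the cube into a colouring of the \<open>p\<close>-element sets
  \<open>I\<close> of positions. On a set \<open>S\<close> homogeneous for this colouring, all points supported in \<open>S\<close>
  with word \<open>w\<close> have the same colour. So it suffices to find a \<open>d\<close>-element set that is
  homogeneous simultaneously for all words of length at most \<open>d\<close>. There are finitely many such
  words, and applying Ramsey's theorem for hypergraphs once per word, shrinking the set each time,
  gives it (\<open>simultaneous_ramsey\<close>).

  The words are taken over the whole alphabet \<open>{1..m}\<close>, including \<open>t\<close>: their number and lengths,
  and hence the resulting \<open>n\<close>, are then the same for all \<open>t\<close>.
\<close>

text \<open>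
  The ground set and the colours are transported along bijections to initial segments of the
  naturals, where this is the multicolour Ramsey theorem with all \<open>r\<close> target sizes equal to \<open>q\<close>.
\<close>

lemma ramsey_finite_colours:
  "\<exists>N. \<forall>(A :: 'a set) C f. finite A \<and> N \<le> card A \<and> finite C \<and> card C = r \<and> f \<in> nsets A p \<rightarrow> C
      \<longrightarrow> (\<exists>H \<in> nsets A q. \<exists>k. f ` nsets H p \<subseteq> {k})"
proof -
  obtain N :: nat where N: "partn_lst {..<N} (replicate r q) p"
    using ramsey_full by blast
  show ?thesis
  proof (intro exI[of _ N] allI impI, elim conjE)
    fix A :: "'a set" and C and f :: "'a set \<Rightarrow> 'b"
    assume A: "finite A" "N \<le> card A" and C: "finite C" "card C = r"
      and f: "f \<in> nsets A p \<rightarrow> C"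
    obtain B where B: "B \<subseteq> A" "card B = N" "finite B"
      using A obtain_subset_with_card_n by metis
    then obtain g where g: "bij_betw g {..<N} B"
      using ex_bij_betw_nat_finite[of B] by (auto simp: atLeast0LessThan)
    obtain h where h: "bij_betw h C {..<r}"
      using C ex_bij_betw_finite_nat[of C] by (auto simp: atLeast0LessThan)
    have im: "g ` X \<in> nsets B s" if "X \<in> nsets {..<N} s" for X s
      using bij_betw_nsets[OF g] that by (metis bij_betwE)
    have "(\<lambda>X. h (f (g ` X))) \<in> nsets {..<N} p \<rightarrow> {..<r}"
      using im nsets_mono[OF B(1)] f bij_betwE[OF h] by blast
    then obtain i H where i: "i < r" and H: "H \<in> nsets {..<N} q"
      and mono: "(\<lambda>X. h (f (g ` X))) ` nsets H p \<subseteq> {i}"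
      using N unfolding partn_lst_def monochromatic_def by fastforce
    have HN: "H \<subseteq> {..<N}"
      using H by (auto simp: nsets_def)
    have "inj_on g H"
      using g HN by (auto simp: bij_betw_def intro: inj_on_subset)
    have "f Y = inv_into C h i" if Y: "Y \<in> nsets (g ` H) p" for Y
    proof -
      obtain X where X: "X \<in> nsets H p" "Y = g ` X"
        using Y \<open>inj_on g H\<close> by (rule nset_image_obtains)
      have "Y \<in> nsets A p"
        using X im nsets_mono[OF HN] nsets_mono[OF B(1)] by blast
      then have "f Y \<in> C"
        using f by blast
      moreover have "h (f Y) = i"
        using mono X by auto
      ultimately show ?thesis
        using h by (metis bij_betw_inv_into_left)
    qed
    moreover have "g ` H \<in> nsets A q"
      using im[OF H] nsets_mono[OF B(1)] by blast
    ultimately show "\<exists>H \<in> nsets A q. \<exists>k. f ` nsets H p \<subseteq> {k}"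
      by blast
  qed
qed

text \<open>
  Homogeneity passes to subsets, so the colourings can be treated one after another: each one
  asks for a homogeneous set large enough to serve as ground set for the remaining ones.
\<close>

lemma simultaneous_ramsey:
  fixes p :: "'j \<Rightarrow> nat"
  assumes "finite J"
  shows "\<exists>N. \<forall>(A :: 'a set) C f. finite A \<and> N \<le> card A \<and> finite C \<and> card C = r
        \<and> (\<forall>j\<in>J. f j \<in> nsets A (p j) \<rightarrow> C)
      \<longrightarrow> (\<exists>H \<in> nsets A d. \<forall>j\<in>J. \<exists>k. f j ` nsets H (p j) \<subseteq> {k})"
  using assms
proof (induction J)
  case empty
  show ?case
  proof (intro exI[of _ d] allI impI)
    fix A :: "'a set" and C :: "'b set" and f :: "'j \<Rightarrow> 'a set \<Rightarrow> 'b"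
    assume "finite A \<and> d \<le> card A \<and> finite C \<and> card C = r
      \<and> (\<forall>j\<in>{}. f j \<in> nsets A (p j) \<rightarrow> C)"
    then have "nsets A d \<noteq> {}"
      by (simp add: nsets_eq_empty_iff)
    then show "\<exists>H \<in> nsets A d. \<forall>j\<in>{}. \<exists>k. f j ` nsets H (p j) \<subseteq> {k}"
      by blast
  qed
next
  case (insert j J)
  then obtain M where M: "\<And>(A :: 'a set) (C :: 'b set) f. finite A \<Longrightarrow> M \<le> card A \<Longrightarrow> finite C
      \<Longrightarrow> card C = r \<Longrightarrow> (\<forall>j\<in>J. f j \<in> nsets A (p j) \<rightarrow> C)
      \<Longrightarrow> \<exists>H \<in> nsets A d. \<forall>j\<in>J. \<exists>k. f j ` nsets H (p j) \<subseteq> {k}"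
    by metis
  obtain N where N: "\<And>(A :: 'a set) (C :: 'b set) f. finite A \<Longrightarrow> N \<le> card A \<Longrightarrow> finite C
      \<Longrightarrow> card C = r \<Longrightarrow> f \<in> nsets A (p j) \<rightarrow> C
      \<Longrightarrow> \<exists>H \<in> nsets A M. \<exists>k. f ` nsets H (p j) \<subseteq> {k}"
    using ramsey_finite_colours[of r "p j" M] by metis
  show ?case
  proof (intro exI[of _ N] allI impI, elim conjE)
    fix A :: "'a set" and C :: "'b set" and f :: "'j \<Rightarrow> 'a set \<Rightarrow> 'b"
    assume A: "finite A" "N \<le> card A" and C: "finite C" "card C = r"
      and f: "\<forall>i\<in>insert j J. f i \<in> nsets A (p i) \<rightarrow> C"
    obtain B k where B: "B \<in> nsets A M" and k: "f j ` nsets B (p j) \<subseteq> {k}"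
      using N[OF A C, of "f j"] f by blast
    have BA: "B \<subseteq> A" "finite B" "M \<le> card B"
      using B by (auto simp: nsets_def)
    have "\<forall>i\<in>J. f i \<in> nsets B (p i) \<rightarrow> C"
      using f by (auto dest!: subsetD[OF nsets_mono[OF BA(1)]])
    then obtain H where H: "H \<in> nsets B d" "\<forall>i\<in>J. \<exists>k. f i ` nsets H (p i) \<subseteq> {k}"
      using M[OF BA(2,3) C] by blast
    have "H \<subseteq> B"
      using H by (auto simp: nsets_def)
    then have "f j ` nsets H (p j) \<subseteq> {k}"
      using k nsets_mono by blast
    then have "\<forall>i\<in>insert j J. \<exists>k. f i ` nsets H (p i) \<subseteq> {k}"
      using H by blast
    moreover have "H \<in> nsets A d"
      using H nsets_mono[OF BA(1)] by blast
    ultimately show "\<exists>H \<in> nsets A d. \<forall>i\<in>insert j J. \<exists>k. f i ` nsets H (p i) \<subseteq> {k}"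
      by blast
  qed
qed

definition spread :: "nat \<Rightarrow> 'a \<Rightarrow> 'a list \<Rightarrow> nat set \<Rightarrow> nat \<Rightarrow> 'a" where
  "spread n t w I =
     (\<lambda>i\<in>{1..n}. case map_of (zip (sorted_list_of_set I) w) i of None \<Rightarrow> t | Some a \<Rightarrow> a)"

lemma spread_in_cube:
  assumes "t \<in> {1..m}" and "set w \<subseteq> {1..m}"
  shows "spread n t w I \<in> cube m n"
proof -
  have "a \<in> {1..m}" if "map_of (zip (sorted_list_of_set I) w) i = Some a" for i a
    using that assms(2) by (meson map_of_SomeD set_zip_rightD subsetD)
  then show ?thesis
    using assms(1) by (auto simp: cube_def spread_def split: option.split)
qed

text \<open>
  This is what turns a colouring of points into one of position sets: every point of the cube
  lies in the image of \<open>spread\<close>, with parameters read off from the point itself.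
\<close>

lemma spread_subtuple:
  assumes "x \<in> cube m n"
  shows "spread n t (subtuple x (positions_ne n t x)) (positions_ne n t x) = x"
proof
  fix i
  have "finite (positions_ne n t x)"
    by (simp add: positions_ne_def)
  then show "spread n t (subtuple x (positions_ne n t x)) (positions_ne n t x) i = x i"
    using assms
    by (auto simp: spread_def subtuple_def map_of_zip_map positions_ne_def cube_def
        PiE_def extensional_def restrict_def)
qed

theorem lemma2:
  fixes d m r :: nat
  assumes "d > 0" and "m > 0" and "r > 0"
  shows "\<exists>n>0. \<forall>t\<in>{1..m}. \<forall>c :: (nat \<Rightarrow> nat) \<Rightarrow> nat. coloring r (cube m n) c \<longrightarrow>
    (\<exists>S\<subseteq>{1..n}. card S = d \<and>
      (\<forall>x\<in>{z \<in> cube m n. positions_ne n t z \<subseteq> S}.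
       \<forall>y\<in>{z \<in> cube m n. positions_ne n t z \<subseteq> S}.
         t_equivalent n t x y \<longrightarrow> c x = c y))"
proof -
  define W where "W = {w. set w \<subseteq> {1..m} \<and> length w \<le> d}"
  have "finite W"
    unfolding W_def by (rule finite_lists_length_le) simp
  then obtain N where N: "\<And>(A :: nat set) (C :: nat set) f. finite A \<Longrightarrow> N \<le> card A \<Longrightarrow> finite C
      \<Longrightarrow> card C = r \<Longrightarrow> (\<forall>w\<in>W. f w \<in> nsets A (length w) \<rightarrow> C)
      \<Longrightarrow> \<exists>H \<in> nsets A d. \<forall>w\<in>W. \<exists>k. f w ` nsets H (length w) \<subseteq> {k}"
    using simultaneous_ramsey[of W r length d] by metis
  define n where "n = max N 1"
  show ?thesis
  proof (intro exI[of _ n] conjI ballI allI impI)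
    show "n > 0"
      by (simp add: n_def)
    fix t :: nat and c :: "(nat \<Rightarrow> nat) \<Rightarrow> nat"
    assume t: "t \<in> {1..m}" and "coloring r (cube m n) c"
    then obtain C where C: "finite C" "card C = r" and c: "c \<in> cube m n \<rightarrow> C"
      unfolding coloring_def by blast
    have "\<forall>w\<in>W. (\<lambda>I. c (spread n t w I)) \<in> nsets {1..n} (length w) \<rightarrow> C"
      using c spread_in_cube[OF t] by (auto simp: W_def)
    then obtain S where S: "S \<in> nsets {1..n} d"
      and hom: "\<forall>w\<in>W. \<exists>k. (\<lambda>I. c (spread n t w I)) ` nsets S (length w) \<subseteq> {k}"
      using N[of "{1..n}" C "\<lambda>w I. c (spread n t w I)"] C by (auto simp: n_def)
    have Sn: "S \<subseteq> {1..n}" "card S = d" "finite S"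
      using S by (auto simp: nsets_def)
    have support: "positions_ne n t z \<in> nsets S (length (subtuple z (positions_ne n t z)))
        \<and> subtuple z (positions_ne n t z) \<in> W"
      if z: "z \<in> cube m n" "positions_ne n t z \<subseteq> S" for z
    proof -
      have fin: "finite (positions_ne n t z)"
        by (simp add: positions_ne_def)
      moreover have "card (positions_ne n t z) \<le> d"
        using Sn card_mono z(2) by blast
      moreover have "z ` positions_ne n t z \<subseteq> {1..m}"
        using z(1) unfolding cube_def positions_ne_def by blast
      ultimately show ?thesis
        using z(2) by (simp add: subtuple_def nsets_def W_def)
    qed
    have "c x = c y"
      if x: "x \<in> cube m n" "positions_ne n t x \<subseteq> S"
        and y: "y \<in> cube m n" "positions_ne n t y \<subseteq> S"
        and eq: "t_equivalent n t x y" for x y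
    proof -
      define w where "w = subtuple x (positions_ne n t x)"
      have wy: "subtuple y (positions_ne n t y) = w"
        using eq by (simp add: w_def t_equivalent_def)
      have I: "positions_ne n t x \<in> nsets S (length w)" "positions_ne n t y \<in> nsets S (length w)"
        and "w \<in> W"
        using support[OF x] support[OF y] wy by (auto simp: w_def)
      then have "c (spread n t w (positions_ne n t x)) = c (spread n t w (positions_ne n t y))"
        using hom by blast
      moreover have "spread n t w (positions_ne n t x) = x"
        using spread_subtuple[OF x(1)] by (simp add: w_def)
      moreover have "spread n t w (positions_ne n t y) = y"
        using spread_subtuple[OF y(1)] wy by metis
      ultimately show ?thesis
        by simp
    qed
    then show "\<exists>S\<subseteq>{1..n}. card S = d \<and>
      (\<forall>x\<in>{z \<in> cube m n. positions_ne n t z \<subseteq> S}.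
       \<forall>y\<in>{z \<in> cube m n. positions_ne n t z \<subseteq> S}.
         t_equivalent n t x y \<longrightarrow> c x = c y)"
      using Sn by blast
  qed
qed

end
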